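(* The tensor $T_{end,7}\in A\otimes B\otimes C=\mathbb{C}^7\otimes\mathbb{C}^7\otimes\mathbb{C}^7$ corresponding to $$T_{end,7}(A^* )=\begin{pmatrix}x_1&&&&&&\\ &x_1&&&&&\\ &&x_1&&&&\\ &&&x_1&&&\\ &x_2+x_7&x_3&x_4&x_1&&\\ x_2&x_3&x_5&x_6&&x_1&\\ x_4&x_5&x_6&x_7&&&x_1\end{pmatrix}$$ is $\mathrm{End}$-closed, but has border rank at least $8$.
   Context: All vector spaces are over $\mathbb{C}$. A matrix of linear forms $\sum_i x_iM_i$ (blank entries are zero) represents the tensor $\sum_i a_i\otimes M_i$, with $\{a_i\}$ a basis of $A$; $T(A^* )$ is the space of matrices obtained as $x_i$ range over $\mathbb{C}$. $T$ is $\mathrm{End}$-closed means that $T$ is $A$-concise (the map $A^*\to B\otimes C$ is injective), and for some $\alpha\in A^*$ with $T(\alpha)$ invertible the space $\{T(\alpha')T(\alpha)^{-1}\mid\alpha'\in A^*\}\subset\mathrm{End}(B)$ consists of commuting endomorphisms and is closed under composition (here one may take $\alpha$ with $T(\alpha)=\mathrm{Id}$). Border rank: the least $r$ such that $T$ is a limit of sums of $r$ tensors $a\otimes b\otimes c$. *)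

theory Defs
  imports "HOL-Analysis.Analysis"
begin

text \<open>
  A tensor in \<open>A \<otimes> B \<otimes> C\<close> is given by its coordinates in fixed bases: \<open>T $ i $ j $ k\<close> is the
  coefficient of \<open>a\<^sub>i \<otimes> b\<^sub>j \<otimes> c\<^sub>k\<close>, so that \<open>T $ i\<close> is the matrix \<open>M\<^sub>i\<close> in
  \<open>T = (\<Sum>i. a\<^sub>i \<otimes> M\<^sub>i)\<close>, with rows indexed by \<open>B\<close> and columns by \<open>C\<close>.
\<close>

type_synonym ('a, 'b, 'c) tensor3 = "complex ^ 'c ^ 'b ^ 'a"

definition rank_one_tensor ::
    "complex ^ 'a \<Rightarrow> complex ^ 'b \<Rightarrow> complex ^ 'c \<Rightarrow> ('a, 'b, 'c) tensor3" where
  "rank_one_tensor a b c = (\<chi> i j k. a $ i * b $ j * c $ k)"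

definition sums_of_rank_one :: "nat \<Rightarrow> ('a::finite, 'b::finite, 'c::finite) tensor3 set" where
  "sums_of_rank_one r = {\<Sum>l<r. rank_one_tensor (a l) (b l) (c l) | a b c. True}"

definition border_rank :: "('a::finite, 'b::finite, 'c::finite) tensor3 \<Rightarrow> nat" where
  "border_rank T = (LEAST r. \<exists>X. (\<forall>n. X n \<in> sums_of_rank_one r) \<and> X \<longlonglongrightarrow> T)"

text \<open>
  The map \<open>A\<^sup>* \<rightarrow> B \<otimes> C\<close> defined by \<open>T\<close>. A functional \<open>\<alpha>\<close> is given by its coordinates
  \<open>\<alpha> $ i = \<alpha>(a\<^sub>i)\<close> in the dual basis.
\<close>

definition contract_A :: "('a::finite, 'b::finite, 'c::finite) tensor3 \<Rightarrow> complex ^ 'a \<Rightarrow> complex ^ 'c ^ 'b" where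
  "contract_A T \<alpha> = (\<chi> j k. \<Sum>i\<in>UNIV. \<alpha> $ i * T $ i $ j $ k)"

definition A_concise :: "('a::finite, 'b::finite, 'c::finite) tensor3 \<Rightarrow> bool" where
  "A_concise T \<longleftrightarrow> inj (contract_A T)"

text \<open>
  A matrix in \<open>B \<otimes> C\<close> is read as a linear map \<open>C\<^sup>* \<rightarrow> B\<close>; hence \<open>T(\<alpha>') T(\<alpha>)\<^sup>-\<^sup>1\<close> is an
  endomorphism of \<open>B\<close>.
\<close>

definition endo_space ::
    "('a::finite, 'b::finite, 'c::finite) tensor3 \<Rightarrow> complex ^ 'a \<Rightarrow> (complex ^ 'b ^ 'b) set" where
  "endo_space T \<alpha> = {contract_A T \<alpha>' ** matrix_inv (contract_A T \<alpha>) | \<alpha>'. True}"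

definition End_closed :: "('a::finite, 'b::finite, 'c::finite) tensor3 \<Rightarrow> bool" where
  "End_closed T \<longleftrightarrow> A_concise T \<and>
     (\<exists>\<alpha>. invertible (contract_A T \<alpha>) \<and>
        (\<forall>X \<in> endo_space T \<alpha>. \<forall>Y \<in> endo_space T \<alpha>. X ** Y = Y ** X) \<and>
        (\<forall>X \<in> endo_space T \<alpha>. \<forall>Y \<in> endo_space T \<alpha>. X ** Y \<in> endo_space T \<alpha>))"

text \<open>
  The indices \<open>1, \<dots>, 7\<close> are elements of the seven-element numeral type, in which \<open>7 = 0\<close>.
\<close>

definition T_end_7_matrix :: "complex ^ 7 \<Rightarrow> complex ^ 7 ^ 7" where
  "T_end_7_matrix x = vector [
     vector [x $ 1, 0,             0,     0,     0,     0,     0    ],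
     vector [0,     x $ 1,         0,     0,     0,     0,     0    ],
     vector [0,     0,             x $ 1, 0,     0,     0,     0    ],
     vector [0,     0,             0,     x $ 1, 0,     0,     0    ],
     vector [0,     x $ 2 + x $ 7, x $ 3, x $ 4, x $ 1, 0,     0    ],
     vector [x $ 2, x $ 3,         x $ 5, x $ 6, 0,     x $ 1, 0    ],
     vector [x $ 4, x $ 5,         x $ 6, x $ 7, 0,     0,     x $ 1]]"

text \<open>\<open>M\<^sub>i\<close> is the value of the matrix of linear forms at the \<open>i\<close>-th basis vector.\<close>

definition T_end_7 :: "(7, 7, 7) tensor3" where
  "T_end_7 = (\<chi> i. T_end_7_matrix (axis i 1))"

lemma UNIV_7: "(UNIV :: 7 set) = {1, 2, 3, 4, 5, 6, 7}"
proof -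
  have "card {1, 2, 3, 4, 5, 6, 7 :: 7} = CARD(7)"
    by simp
  then show ?thesis
    by (metis card_eq_UNIV_imp_eq_UNIV finite)
qed

lemma vector_7:
  fixes a1 a2 a3 a4 a5 a6 a7 :: "'a::zero"
  defines "v \<equiv> vector [a1, a2, a3, a4, a5, a6, a7] :: 'a ^ 7"
  shows "v $ 1 = a1" "v $ 2 = a2" "v $ 3 = a3" "v $ 4 = a4" "v $ 5 = a5" "v $ 6 = a6" "v $ 7 = a7"
  by (simp_all add: v_def vector_def)

lemma contract_A_T_end_7: "contract_A T_end_7 x = T_end_7_matrix x"
proof -
  have all7: "(\<forall>i. P i) \<longleftrightarrow> P 1 \<and> P 2 \<and> P 3 \<and> P 4 \<and> P 5 \<and> P 6 \<and> P 7" for P :: "7 \<Rightarrow> bool"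
    using UNIV_7 by (metis (full_types) UNIV_I insertE singletonD)
  have sum7: "(\<Sum>i\<in>UNIV. f i) = f 1 + f 2 + f 3 + f 4 + f 5 + f 6 + f 7" for f :: "7 \<Rightarrow> complex"
    unfolding UNIV_7 by (simp add: add.assoc)
  show ?thesis
    unfolding vec_eq_iff all7
    by (simp add: contract_A_def T_end_7_def T_end_7_matrix_def vector_7 sum7 axis_def algebra_simps)
qed

lemma sums_of_rank_one_exhaust:
  fixes T :: "('a::finite, 'b::finite, 'c::finite) tensor3"
  shows "\<exists>r. T \<in> sums_of_rank_one r"
proof -
  define S where "S = (UNIV :: ('a \<times> 'b \<times> 'c) set)"
  obtain h where h: "bij_betw h {..<card S} S"
    using ex_bij_betw_nat_finite[of S] by (auto simp: S_def atLeast0LessThan)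
  define f where "f = (\<lambda>(i :: 'a, j :: 'b, k :: 'c).
    rank_one_tensor (axis i (T $ i $ j $ k)) (axis j 1) (axis k 1))"
  have "T $ p $ q $ s = (\<Sum>l\<in>S. f l) $ p $ q $ s" for p q s
  proof -
    have "(\<Sum>l\<in>S. f l) $ p $ q $ s = (\<Sum>l\<in>S. if l = (p, q, s) then T $ p $ q $ s else 0)"
      unfolding sum_component
      by (rule sum.cong) (auto simp: f_def rank_one_tensor_def axis_def split: if_splits)
    then show ?thesis
      by (simp add: S_def)
  qed
  then have "T = (\<Sum>l\<in>S. f l)"
    by (simp add: vec_eq_iff)
  also have "\<dots> = (\<Sum>l<card S. f (h l))"
    using sum.reindex_bij_betw[OF h, of f] by simp
  finally have "T \<in> sums_of_rank_one (card S)"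
    unfolding sums_of_rank_one_def f_def case_prod_beta mem_Collect_eq
    by (intro exI conjI TrueI)
  then show ?thesis ..
qed

text \<open>The minimum in the definition of \<^const>\<open>border_rank\<close> is attained.\<close>

lemma border_rank_attained:
  "\<exists>X. (\<forall>n. X n \<in> sums_of_rank_one (border_rank T)) \<and> X \<longlonglongrightarrow> T"
proof -
  obtain r where "T \<in> sums_of_rank_one r"
    using sums_of_rank_one_exhaust by blast
  then have "\<exists>X. (\<forall>n. X n \<in> sums_of_rank_one r) \<and> X \<longlonglongrightarrow> T"
    by (intro exI[of _ "\<lambda>_. T"]) simp
  then show ?thesis
    unfolding border_rank_def by (rule LeastI)
qed

end

theory Submission
  imports Defs
begin

text \<open>
  The algebra \<open>E = T(A\<^sup>*)\<close> consists of the scalars and a square-zero ideal of block matrices whose only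
  nonzero block is the \<open>3 \<times> 4\<close> block \<open>S\<^sub>i\<close> in the lower left corner. If \<open>T\<close> were a limit of tensors of
  rank at most \<open>7\<close>, then \<open>E\<close> would be a limit of algebras spanned by commuting matrices \<open>N\<^sub>1 = Id, N\<^sub>2, \<dots>, N\<^sub>7\<close>
  which are simultaneously diagonalizable, hence without nilpotents. Write \<open>P\<^sub>i\<close>, \<open>R\<^sub>i\<close> for the diagonal blocks of \<open>N\<^sub>i\<close>
  and \<open>S\<^sub>i\<close> for the lower left one. The lower left block of the multiplication table
  \<open>N\<^sub>i N\<^sub>j = (\<Sum>k. c\<^sub>i\<^sub>j\<^sub>k N\<^sub>k)\<close> reads \<open>S\<^sub>i P\<^sub>j + R\<^sub>i S\<^sub>j = (\<Sum>k\<ge>2. c\<^sub>i\<^sub>j\<^sub>k S\<^sub>k)\<close>, which is a homogeneous linear system for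
  \<open>(P, R, c)\<close> with coefficients depending only on \<open>S\<close>. The trivial solutions come from adding scalars to the \<open>N\<^sub>i\<close> and
  from conjugating by unipotent matrices, and are removed by requiring \<open>N\<^sub>i\<close> to be traceless for \<open>i \<ge> 2\<close> and
  \<open>N\<^sub>3 e\<^sub>3 = e\<^sub>5\<close>, \<open>N\<^sub>5 e\<^sub>3 = e\<^sub>6\<close>, \<open>N\<^sub>6 e\<^sub>3 = e\<^sub>7\<close>. At \<open>T\<close> the normalized system has only the zero solution, so the same holds near
  \<open>T\<close>. Thus \<open>N\<^sub>3\<close> has zero diagonal blocks and \<open>N\<^sub>3\<^sup>2\<close> is a scalar matrix; comparing the traces of its two diagonal
  blocks gives \<open>N\<^sub>3\<^sup>2 = 0\<close>, hence \<open>N\<^sub>3 = 0\<close>, a contradiction.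
\<close>

section \<open>The space of matrices\<close>

lemma sum_7: "(\<Sum>i\<in>UNIV. f i) = f 1 + f 2 + f 3 + f 4 + f 5 + f 6 + f (7::7)"
  for f :: "7 \<Rightarrow> 'a::comm_monoid_add"
  unfolding UNIV_7 by (simp add: add.assoc)

lemma forall_7: "(\<forall>i::7. P i) \<longleftrightarrow> P 1 \<and> P 2 \<and> P 3 \<and> P 4 \<and> P 5 \<and> P 6 \<and> P 7"
  using UNIV_7 by (metis (full_types) UNIV_I insertE singletonD)

lemma T_end_7_nth: "T_end_7 $ i = T_end_7_matrix (axis i 1)"
  by (simp add: T_end_7_def)

text \<open>Each matrix is a scalar plus a block in rows 5 to 7 and columns 1 to 4. Two such blocks
  multiply to zero, so only the scalar and mixed terms survive.\<close>

lemma T_end_7_matrix_mult: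
  "T_end_7_matrix x ** T_end_7_matrix y =
     T_end_7_matrix (\<chi> i. if i = 1 then x $ 1 * y $ 1 else x $ 1 * y $ i + x $ i * y $ 1)"
  unfolding vec_eq_iff forall_7 T_end_7_matrix_def
  by (simp add: matrix_matrix_mult_def sum_7 vector_7 algebra_simps)

lemma T_end_7_matrix_axis_1: "T_end_7_matrix (axis 1 1) = mat 1"
  unfolding vec_eq_iff forall_7 T_end_7_matrix_def
  by (simp add: mat_def vector_7 axis_def)

text \<open>The linearized multiplication table lives in the lower left block: rows 5 to 7 here,
  columns 1 to 4 in the mirror statement.\<close>

lemma T_end_7_matrix_mult_left:
  "(T_end_7_matrix x ** A) $ 5 $ b = x $ 1 * A $ 5 $ b + (x $ 2 + x $ 7) * A $ 2 $ b +
     x $ 3 * A $ 3 $ b + x $ 4 * A $ 4 $ b"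
  "(T_end_7_matrix x ** A) $ 6 $ b = x $ 1 * A $ 6 $ b + x $ 2 * A $ 1 $ b +
     x $ 3 * A $ 2 $ b + x $ 5 * A $ 3 $ b + x $ 6 * A $ 4 $ b"
  "(T_end_7_matrix x ** A) $ 7 $ b = x $ 1 * A $ 7 $ b + x $ 4 * A $ 1 $ b +
     x $ 5 * A $ 2 $ b + x $ 6 * A $ 3 $ b + x $ 7 * A $ 4 $ b"
  by (simp_all add: matrix_matrix_mult_def sum_7 T_end_7_matrix_def vector_7 algebra_simps)

lemma T_end_7_matrix_mult_right:
  "(A ** T_end_7_matrix x) $ a $ 1 = A $ a $ 1 * x $ 1 + A $ a $ 6 * x $ 2 + A $ a $ 7 * x $ 4"
  "(A ** T_end_7_matrix x) $ a $ 2 = A $ a $ 2 * x $ 1 + A $ a $ 5 * (x $ 2 + x $ 7) +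
     A $ a $ 6 * x $ 3 + A $ a $ 7 * x $ 5"
  "(A ** T_end_7_matrix x) $ a $ 3 = A $ a $ 3 * x $ 1 + A $ a $ 5 * x $ 3 +
     A $ a $ 6 * x $ 5 + A $ a $ 7 * x $ 6"
  "(A ** T_end_7_matrix x) $ a $ 4 = A $ a $ 4 * x $ 1 + A $ a $ 5 * x $ 4 +
     A $ a $ 6 * x $ 6 + A $ a $ 7 * x $ 7"
  by (simp_all add: matrix_matrix_mult_def sum_7 T_end_7_matrix_def vector_7 algebra_simps)

lemma axis_7:
  "axis (2 :: 7) (1 :: complex) $ 1 = 0" "axis (2 :: 7) (1 :: complex) $ 2 = 1"
  "axis (2 :: 7) (1 :: complex) $ 3 = 0" "axis (2 :: 7) (1 :: complex) $ 4 = 0"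
  "axis (2 :: 7) (1 :: complex) $ 5 = 0" "axis (2 :: 7) (1 :: complex) $ 6 = 0"
  "axis (2 :: 7) (1 :: complex) $ 7 = 0"
  "axis (3 :: 7) (1 :: complex) $ 1 = 0" "axis (3 :: 7) (1 :: complex) $ 2 = 0"
  "axis (3 :: 7) (1 :: complex) $ 3 = 1" "axis (3 :: 7) (1 :: complex) $ 4 = 0"
  "axis (3 :: 7) (1 :: complex) $ 5 = 0" "axis (3 :: 7) (1 :: complex) $ 6 = 0"
  "axis (3 :: 7) (1 :: complex) $ 7 = 0"
  "axis (4 :: 7) (1 :: complex) $ 1 = 0" "axis (4 :: 7) (1 :: complex) $ 2 = 0"
  "axis (4 :: 7) (1 :: complex) $ 3 = 0" "axis (4 :: 7) (1 :: complex) $ 4 = 1"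
  "axis (4 :: 7) (1 :: complex) $ 5 = 0" "axis (4 :: 7) (1 :: complex) $ 6 = 0"
  "axis (4 :: 7) (1 :: complex) $ 7 = 0"
  "axis (5 :: 7) (1 :: complex) $ 1 = 0" "axis (5 :: 7) (1 :: complex) $ 2 = 0"
  "axis (5 :: 7) (1 :: complex) $ 3 = 0" "axis (5 :: 7) (1 :: complex) $ 4 = 0"
  "axis (5 :: 7) (1 :: complex) $ 5 = 1" "axis (5 :: 7) (1 :: complex) $ 6 = 0"
  "axis (5 :: 7) (1 :: complex) $ 7 = 0"
  "axis (6 :: 7) (1 :: complex) $ 1 = 0" "axis (6 :: 7) (1 :: complex) $ 2 = 0"
  "axis (6 :: 7) (1 :: complex) $ 3 = 0" "axis (6 :: 7) (1 :: complex) $ 4 = 0"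
  "axis (6 :: 7) (1 :: complex) $ 5 = 0" "axis (6 :: 7) (1 :: complex) $ 6 = 1"
  "axis (6 :: 7) (1 :: complex) $ 7 = 0"
  "axis (7 :: 7) (1 :: complex) $ 1 = 0" "axis (7 :: 7) (1 :: complex) $ 2 = 0"
  "axis (7 :: 7) (1 :: complex) $ 3 = 0" "axis (7 :: 7) (1 :: complex) $ 4 = 0"
  "axis (7 :: 7) (1 :: complex) $ 5 = 0" "axis (7 :: 7) (1 :: complex) $ 6 = 0"
  "axis (7 :: 7) (1 :: complex) $ 7 = 1"
  by (simp_all add: axis_def)

section \<open>Inverse matrices and End-closedness\<close>

lemma matrix_inv_mult:
  assumes "invertible A"
  shows "A ** matrix_inv A = mat 1" "matrix_inv A ** A = mat 1"
  using assms someI_ex[of "\<lambda>A'. A ** A' = mat 1 \<and> A' ** A = mat 1"]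
  by (auto simp: invertible_def matrix_inv_def)

lemma matrix_inv_mat_1: "matrix_inv (mat 1 :: complex ^ 'n::finite ^ 'n) = mat 1"
  using matrix_inv_mult(1)[of "mat 1 :: complex ^ 'n ^ 'n"] by (auto simp: invertible_def)

lemma inj_T_end_7_matrix: "inj T_end_7_matrix"
proof (rule injI)
  fix x y assume "T_end_7_matrix x = T_end_7_matrix y"
  then have *: "T_end_7_matrix x $ i $ j = T_end_7_matrix y $ i $ j" for i j by simp
  show "x = y"
    unfolding vec_eq_iff forall_7
    \<comment> \<open>These positions carry the single variables \<open>x $ 1\<close> to
      \<open>x $ 7\<close>, in this order.\<close>
    using *[of 1 1] *[of 6 1] *[of 6 2] *[of 5 4] *[of 6 3] *[of 6 4] *[of 7 4]
    by (simp add: T_end_7_matrix_def vector_7)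
qed

text \<open>At the first basis functional the matrix is the identity, so the endomorphism space is
  the range of \<open>T_end_7_matrix\<close>; the rest is read off the product formula.\<close>

lemma End_closed_T_end_7: "End_closed T_end_7"
proof -
  have "A_concise T_end_7"
    using inj_T_end_7_matrix by (simp add: A_concise_def contract_A_T_end_7 inj_on_def)
  moreover have "invertible (contract_A T_end_7 (axis 1 1))"
    by (auto simp: contract_A_T_end_7 T_end_7_matrix_axis_1 invertible_def)
  moreover have "endo_space T_end_7 (axis 1 1) = range T_end_7_matrix"
    by (auto simp: endo_space_def contract_A_T_end_7 T_end_7_matrix_axis_1 matrix_inv_mat_1)
  moreover have comm: "T_end_7_matrix x ** T_end_7_matrix y = T_end_7_matrix y ** T_end_7_matrix x" for x y
    unfolding T_end_7_matrix_mult
    by (rule arg_cong[of _ _ T_end_7_matrix]) (simp add: vec_eq_iff algebra_simps)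
  ultimately show ?thesis
    unfolding End_closed_def
    by (intro conjI exI[of _ "axis 1 1"]) (auto simp: comm, auto simp: T_end_7_matrix_mult)
qed

section \<open>Infinitesimal rigidity\<close>

text \<open>
  The hypotheses \<open>mem\<close> and \<open>sym\<close> are the linearization at \<open>T\<close> of being closed under multiplication and
  commutative. The fact \<open>e\<close> with index
  \<open>ij\<close> collects the equations given by \<open>mem\<close> for the pair \<open>(i, j)\<close>. The system is so sparse that at every step of the
  elimination the equations used have at most two terms left.
\<close>

lemma T_end_7_deformation_eq_0:
  fixes D :: "7 \<Rightarrow> complex ^ 7 ^ 7"
  assumes block: "\<And>i a b. (a \<in> {5, 6, 7}) \<noteq> (b \<in> {5, 6, 7}) \<Longrightarrow> D i $ a $ b = 0"
    and mem: "\<And>i j. i \<noteq> 1 \<Longrightarrow> j \<noteq> 1 \<Longrightarrow>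
      \<exists>y. T_end_7 $ i ** D j + D i ** T_end_7 $ j = T_end_7_matrix y"
    and sym: "\<And>i j. i \<noteq> 1 \<Longrightarrow> j \<noteq> 1 \<Longrightarrow>
      T_end_7 $ i ** D j + D i ** T_end_7 $ j = T_end_7 $ j ** D i + D j ** T_end_7 $ i"
    and trace: "\<And>i. i \<noteq> 1 \<Longrightarrow> trace (D i) = 0"
    and col: "\<And>a. D 3 $ a $ 3 = 0" "\<And>a. D 5 $ a $ 3 = 0" "\<And>a. D 6 $ a $ 3 = 0"
    and i: "i \<noteq> 1"
  shows "D i = 0"
proof -
  define L where "L = (\<lambda>i j. T_end_7 $ i ** D j + D i ** T_end_7 $ j)"
  have zero:
    "D i $ 1 $ 5 = 0" "D i $ 1 $ 6 = 0" "D i $ 1 $ 7 = 0"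
    "D i $ 2 $ 5 = 0" "D i $ 2 $ 6 = 0" "D i $ 2 $ 7 = 0"
    "D i $ 3 $ 5 = 0" "D i $ 3 $ 6 = 0" "D i $ 3 $ 7 = 0"
    "D i $ 4 $ 5 = 0" "D i $ 4 $ 6 = 0" "D i $ 4 $ 7 = 0"
    "D i $ 5 $ 1 = 0" "D i $ 5 $ 2 = 0" "D i $ 5 $ 3 = 0"
    "D i $ 5 $ 4 = 0" "D i $ 6 $ 1 = 0" "D i $ 6 $ 2 = 0"
    "D i $ 6 $ 3 = 0" "D i $ 6 $ 4 = 0" "D i $ 7 $ 1 = 0"
    "D i $ 7 $ 2 = 0" "D i $ 7 $ 3 = 0" "D i $ 7 $ 4 = 0" for i
    by (simp_all add: block)
  have trace_eq: "D i $ 1 $ 1 + D i $ 2 $ 2 + D i $ 3 $ 3 + D i $ 4 $ 4 + D i $ 5 $ 5 + D i $ 6 $ 6 + D i $ 7 $ 7 = 0"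
    if "i \<noteq> 1" for i
    using trace[OF that] by (simp add: trace_def sum_7)
  \<comment> \<open>The lower left block has 12 entries but 6 parameters; these six relations cut
    out its possible values.\<close>
  have mem_L: "L i j $ 5 $ 1 = 0 \<and> L i j $ 5 $ 2 = L i j $ 6 $ 1 + L i j $ 7 $ 4 \<and>
      L i j $ 5 $ 3 = L i j $ 6 $ 2 \<and> L i j $ 5 $ 4 = L i j $ 7 $ 1 \<and>
      L i j $ 6 $ 3 = L i j $ 7 $ 2 \<and> L i j $ 6 $ 4 = L i j $ 7 $ 3"
    if ij: "i \<noteq> 1" "j \<noteq> 1" for i j
  proof -
    obtain y where y: "L i j = T_end_7_matrix y"
      using mem[OF ij] by (auto simp: L_def)
    show ?thesis
      unfolding y by (simp add: T_end_7_matrix_def vector_7)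
  qed
  have sym_L: "L i j $ r $ c = L j i $ r $ c" if ij: "i \<noteq> 1" "j \<noteq> 1" for i j r c
    using sym[OF ij] by (simp add: L_def)
  have ne: "(2 :: 7) \<noteq> 1" "(3 :: 7) \<noteq> 1" "(4 :: 7) \<noteq> 1" "(5 :: 7) \<noteq> 1" "(6 :: 7) \<noteq> 1" "(7 :: 7) \<noteq> 1"
    by simp_all
  note entries = T_end_7_matrix_mult_left T_end_7_matrix_mult_right
  note M = mem_L[unfolded L_def T_end_7_nth vector_add_component entries zero]
  note N = sym_L[unfolded L_def T_end_7_nth vector_add_component]
  note e22 = M[OF ne(1) ne(1), unfolded axis_7 col, simplified]
  note e23 = M[OF ne(1) ne(2), unfolded axis_7 col, simplified]
  note e24 = M[OF ne(1) ne(3), unfolded axis_7 col, simplified]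
  note e25 = M[OF ne(1) ne(4), unfolded axis_7 col, simplified]
  note e26 = M[OF ne(1) ne(5), unfolded axis_7 col, simplified]
  note e27 = M[OF ne(1) ne(6), unfolded axis_7 col, simplified]
  note e32 = M[OF ne(2) ne(1), unfolded axis_7 col, simplified]
  note e33 = M[OF ne(2) ne(2), unfolded axis_7 col, simplified]
  note e34 = M[OF ne(2) ne(3), unfolded axis_7 col, simplified]
  note e35 = M[OF ne(2) ne(4), unfolded axis_7 col, simplified]
  note e36 = M[OF ne(2) ne(5), unfolded axis_7 col, simplified]
  note e37 = M[OF ne(2) ne(6), unfolded axis_7 col, simplified]
  note e42 = M[OF ne(3) ne(1), unfolded axis_7 col, simplified]
  note e43 = M[OF ne(3) ne(2), unfolded axis_7 col, simplified]
  note e44 = M[OF ne(3) ne(3), unfolded axis_7 col, simplified]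
  note e45 = M[OF ne(3) ne(4), unfolded axis_7 col, simplified]
  note e46 = M[OF ne(3) ne(5), unfolded axis_7 col, simplified]
  note e47 = M[OF ne(3) ne(6), unfolded axis_7 col, simplified]
  note e52 = M[OF ne(4) ne(1), unfolded axis_7 col, simplified]
  note e53 = M[OF ne(4) ne(2), unfolded axis_7 col, simplified]
  note e54 = M[OF ne(4) ne(3), unfolded axis_7 col, simplified]
  note e55 = M[OF ne(4) ne(4), unfolded axis_7 col, simplified]
  note e56 = M[OF ne(4) ne(5), unfolded axis_7 col, simplified]
  note e57 = M[OF ne(4) ne(6), unfolded axis_7 col, simplified]
  note e62 = M[OF ne(5) ne(1), unfolded axis_7 col, simplified]
  note e64 = M[OF ne(5) ne(3), unfolded axis_7 col, simplified]
  note e66 = M[OF ne(5) ne(5), unfolded axis_7 col, simplified]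
  note e72 = M[OF ne(6) ne(1), unfolded axis_7 col, simplified]
  note e73 = M[OF ne(6) ne(2), unfolded axis_7 col, simplified]
  note e74 = M[OF ne(6) ne(3), unfolded axis_7 col, simplified]
  note e75 = M[OF ne(6) ne(4), unfolded axis_7 col, simplified]
  note e76 = M[OF ne(6) ne(5), unfolded axis_7 col, simplified]
  note e77 = M[OF ne(6) ne(6), unfolded axis_7 col, simplified]
  \<comment> \<open>A triple \<open>(i, a, b)\<close> names the unknown \<open>D i $ a $ b\<close>.
    The rounds \<open>z1\<close> to \<open>z5\<close> collect unknowns that vanish outright, later
    rounds using the zeros found before.\<close>
  have z1: "\<forall>(i, a, b) \<in> {(2, 1, 3), (2, 1, 4), (2, 2, 4), (2, 4, 3), (2, 6, 7), (3, 2, 1), (3, 2, 4), (3, 3, 1), (3, 3, 4), (3, 4, 1),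
      (3, 6, 7), (4, 1, 2), (4, 1, 3), (4, 2, 3), (4, 3, 2), (4, 4, 2), (4, 4, 3), (4, 5, 7), (4, 7, 5), (4, 7, 6),
      (5, 2, 1), (5, 2, 4), (5, 3, 1), (5, 3, 4), (5, 4, 1), (5, 5, 6), (5, 5, 7), (6, 2, 1), (6, 3, 1), (6, 4, 1),
      (6, 5, 6), (6, 5, 7), (7, 2, 1), (7, 3, 1), (7, 4, 1), (7, 5, 7), (7, 7, 5), (7, 7, 6)}. D i $ a $ b = 0"
    using e22 e23 e24 e25 e26 e27 e32 e33 e34 e35 e36 e37 e42 e43 e44 e45 e46 e47 e52 e54
      e62 e64 e72 e73 e75 e76
    by simp
  have z2: "\<forall>(i, a, b) \<in> {(2, 1, 2), (2, 4, 1), (2, 4, 2), (2, 7, 5), (2, 7, 6), (3, 7, 5), (3, 7, 6), (4, 2, 1), (4, 4, 1), (4, 6, 5),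
      (5, 7, 5), (5, 7, 6), (6, 3, 2), (6, 4, 2), (7, 1, 2), (7, 1, 4), (7, 2, 4), (7, 4, 2), (7, 6, 5)}. D i $ a $ b = 0"
    using e22 e27 e33 e35 e37 e42 e44 e47 e53 e55 e56 e66 e72 e74 e77 z1
    by simp
  have z3: "\<forall>(i, a, b) \<in> {(2, 2, 1), (2, 2, 3), (2, 3, 4), (2, 5, 7), (2, 6, 5), (3, 1, 2), (3, 1, 4), (3, 4, 2), (3, 6, 5), (4, 5, 6),
      (5, 1, 4), (6, 1, 4), (6, 2, 4), (6, 6, 5), (6, 6, 7), (7, 1, 3), (7, 2, 3), (7, 4, 3), (7, 6, 7)}. D i $ a $ b = 0"
    using e23 e24 e25 e27 e32 e33 e37 e42 e43 e46 e47 e52 e56 e62 e66 e73 e76 z1 z2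
    by simp
  have z4: "\<forall>(i, a, b) \<in> {(2, 5, 6), (4, 1, 4), (4, 2, 4), (4, 6, 7), (5, 4, 2), (6, 1, 2), (7, 5, 6)}. D i $ a $ b = 0"
    using e22 e24 e26 e34 e45 e72 z1 z2 z3
    by simp
  have z5: "\<forall>(i, a, b) \<in> {(5, 1, 2)}. D i $ a $ b = 0"
    using e25 z1 z2 z3 z4
    by simp
  note zs = z1[simplified] z2[simplified] z3[simplified] z4[simplified] z5[simplified]
  \<comment> \<open>With these zeros the membership equations relate pairs of unknowns, and one of
    each pair is eliminated.\<close>
  have q1_1: "D 3 $ 2 $ 2 = D 3 $ 1 $ 1" "D 2 $ 6 $ 6 = D 2 $ 5 $ 5"
    using e23 by (simp_all add: zs col add_eq_0_iff)
  have q1_2: "D 4 $ 2 $ 2 = D 4 $ 1 $ 1" "D 2 $ 7 $ 7 = D 2 $ 5 $ 5"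
    using e24 by (simp_all add: zs col add_eq_0_iff)
  have q1_3: "D 5 $ 2 $ 2 = D 5 $ 1 $ 1"
    using e25 by (simp_all add: zs col add_eq_0_iff)
  have q1_4: "D 6 $ 2 $ 2 = D 6 $ 1 $ 1"
    using e26 by (simp_all add: zs col add_eq_0_iff)
  have q1_5: "D 3 $ 5 $ 6 = - D 2 $ 3 $ 1" "D 2 $ 3 $ 3 = D 2 $ 2 $ 2"
    using e32 by (simp_all add: zs col add_eq_0_iff)
  have q1_6: "D 4 $ 3 $ 1 = - D 3 $ 5 $ 7"
    using e34 by (simp_all add: zs col add_eq_0_iff)
  have q1_7: "D 5 $ 3 $ 2 = - D 3 $ 5 $ 7" "D 3 $ 7 $ 7 = D 3 $ 6 $ 6"
    using e35 by (simp_all add: zs col add_eq_0_iff)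
  have q1_8: "D 7 $ 3 $ 3 = D 7 $ 2 $ 2" "D 7 $ 3 $ 4 = - D 3 $ 5 $ 7"
    using e37 by (simp_all add: zs col add_eq_0_iff)
  have q1_9: "D 4 $ 6 $ 6 = D 4 $ 5 $ 5" "D 2 $ 4 $ 4 = D 2 $ 1 $ 1"
    using e42 by (simp_all add: zs col add_eq_0_iff)
  have q1_10: "D 3 $ 4 $ 4 = D 3 $ 1 $ 1"
    using e43 by (simp_all add: zs col add_eq_0_iff)
  have q1_11: "D 5 $ 4 $ 4 = D 5 $ 1 $ 1"
    using e45 by (simp_all add: zs col add_eq_0_iff)
  have q1_12: "D 6 $ 4 $ 4 = D 6 $ 1 $ 1"
    using e46 by (simp_all add: zs col add_eq_0_iff)
  have q1_13: "D 4 $ 7 $ 7 = D 4 $ 5 $ 5" "D 7 $ 4 $ 4 = D 7 $ 1 $ 1"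
    using e47 by (simp_all add: zs col add_eq_0_iff)
  have q1_14: "D 5 $ 6 $ 5 = - D 2 $ 3 $ 2"
    using e52 by (simp_all add: zs col add_eq_0_iff)
  have q1_15: "D 5 $ 7 $ 7 = D 5 $ 5 $ 5"
    using e54 by (simp_all add: zs col add_eq_0_iff)
  have q1_16: "D 6 $ 6 $ 6 = D 6 $ 5 $ 5" "D 6 $ 7 $ 6 = - D 2 $ 3 $ 1"
    "D 6 $ 7 $ 5 = - D 2 $ 3 $ 2"
    using e62 by (simp_all add: zs col add_eq_0_iff)
  have q1_17: "D 4 $ 4 $ 4 = D 4 $ 3 $ 3"
    using e64 by (simp_all add: zs col add_eq_0_iff)
  have q1_18: "D 7 $ 6 $ 6 = D 7 $ 5 $ 5"
    using e73 by (simp_all add: zs col add_eq_0_iff)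
  have q1_19: "D 7 $ 7 $ 7 = D 7 $ 5 $ 5"
    using e74 by (simp_all add: zs col add_eq_0_iff)
  note q1 = q1_1 q1_2 q1_3 q1_4 q1_5 q1_6 q1_7 q1_8 q1_9 q1_10
    q1_11 q1_12 q1_13 q1_14 q1_15 q1_16 q1_17 q1_18 q1_19
  have q2_1: "D 2 $ 2 $ 2 = D 2 $ 1 $ 1"
    using e22 by (simp_all add: zs col q1 add_eq_0_iff)
  have q2_2: "D 7 $ 2 $ 2 = D 7 $ 1 $ 1"
    using e27 by (simp_all add: zs col q1 add_eq_0_iff)
  have q2_3: "D 3 $ 3 $ 2 = D 2 $ 3 $ 1"
    using e33 by (simp_all add: zs col q1 add_eq_0_iff)
  have q2_4: "D 4 $ 3 $ 3 = D 4 $ 1 $ 1"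
    using e34 by (simp_all add: zs col q1 add_eq_0_iff)
  have q2_5: "D 5 $ 1 $ 1 = - D 2 $ 3 $ 1"
    using e35 by (simp_all add: zs col q1 add_eq_0_iff)
  have q2_6: "D 6 $ 1 $ 1 = D 3 $ 5 $ 7" "D 6 $ 3 $ 4 = D 2 $ 3 $ 1"
    using e36 by (simp_all add: zs col q1 add_eq_0_iff)
  have q2_7: "D 3 $ 1 $ 1 = - D 2 $ 3 $ 2"
    using e53 by (simp_all add: zs col q1 add_eq_0_iff)
  have q2_8: "D 5 $ 6 $ 7 = D 3 $ 5 $ 7" "D 4 $ 3 $ 4 = D 2 $ 3 $ 2"
    using e54 by (simp_all add: zs col q1 add_eq_0_iff)
  have q2_9: "D 7 $ 3 $ 2 = D 2 $ 3 $ 2"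
    using e57 by (simp_all add: zs col q1 add_eq_0_iff)
  note q2 = q2_1 q2_2 q2_3 q2_4 q2_5 q2_6 q2_7 q2_8 q2_9
  \<comment> \<open>Symmetry in \<open>i\<close> and \<open>j\<close> enters here; it ties the
    diagonal of the lower right block to the other unknowns.\<close>
  have q3_1: "D 3 $ 5 $ 5 = - 2 * D 2 $ 3 $ 2"
    using N[OF ne(1) ne(2), of 5 2, unfolded entries zero axis_7 col, simplified]
    by (simp_all add: zs col q1 q2 add_eq_0_iff)
  have q3_2: "D 2 $ 5 $ 5 = D 2 $ 1 $ 1"
    using N[OF ne(1) ne(2), of 5 3, unfolded entries zero axis_7 col, simplified]
    by (simp_all add: zs col q1 q2 add_eq_0_iff)
  have q3_3: "D 3 $ 6 $ 6 = - D 2 $ 3 $ 2"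
    using N[OF ne(1) ne(2), of 6 1, unfolded entries zero axis_7 col, simplified]
    by (simp_all add: zs col q1 q2 add_eq_0_iff)
  have q3_4: "D 4 $ 5 $ 5 = D 4 $ 1 $ 1"
    using N[OF ne(1) ne(3), of 5 2, unfolded entries zero axis_7 col, simplified]
    by (simp_all add: zs col q1 q2 add_eq_0_iff)
  have q3_5: "D 5 $ 5 $ 5 = - D 2 $ 3 $ 1"
    using N[OF ne(1) ne(4), of 5 2, unfolded entries zero axis_7 col, simplified]
    by (simp_all add: zs col q1 q2 add_eq_0_iff)
  have q3_6: "D 5 $ 6 $ 6 = - 2 * D 2 $ 3 $ 1"
    using N[OF ne(1) ne(4), of 6 1, unfolded entries zero axis_7 col, simplified]
    by (simp_all add: zs col q1 q2 add_eq_0_iff)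
  have q3_7: "D 6 $ 5 $ 5 = D 3 $ 5 $ 7"
    using N[OF ne(1) ne(5), of 5 2, unfolded entries zero axis_7 col, simplified]
    by (simp_all add: zs col q1 q2 add_eq_0_iff)
  have q3_8: "D 7 $ 5 $ 5 = D 7 $ 1 $ 1"
    using N[OF ne(1) ne(6), of 6 1, unfolded entries zero axis_7 col, simplified]
    by (simp_all add: zs col q1 q2 add_eq_0_iff)
  have q3_9: "D 6 $ 7 $ 7 = 2 * D 3 $ 5 $ 7"
    using N[OF ne(3) ne(5), of 7 1, unfolded entries zero axis_7 col, simplified]
    by (simp_all add: zs col q1 q2 add_eq_0_iff)
  note q3 = q3_1 q3_2 q3_3 q3_4 q3_5 q3_6 q3_7 q3_8 q3_9
  \<comment> \<open>Six unknowns remain; up to sign, the trace of each \<open>D i\<close> is 7 times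
    a different one of them.\<close>
  have q4_1: "D 2 $ 1 $ 1 = 0"
    using trace_eq[OF ne(1)] by (simp_all add: zs col q1 q2 q3 add_eq_0_iff)
  have q4_2: "D 2 $ 3 $ 2 = 0"
    using trace_eq[OF ne(2)] by (simp_all add: zs col q1 q2 q3 add_eq_0_iff)
  have q4_3: "D 4 $ 1 $ 1 = 0"
    using trace_eq[OF ne(3)] by (simp_all add: zs col q1 q2 q3 add_eq_0_iff)
  have q4_4: "D 2 $ 3 $ 1 = 0"
    using trace_eq[OF ne(4)] by (simp_all add: zs col q1 q2 q3 add_eq_0_iff)
  have q4_5: "D 3 $ 5 $ 7 = 0"
    using trace_eq[OF ne(5)] by (simp_all add: zs col q1 q2 q3 add_eq_0_iff)
  have q4_6: "D 7 $ 1 $ 1 = 0"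
    using trace_eq[OF ne(6)] by (simp_all add: zs col q1 q2 q3 add_eq_0_iff)
  note q4 = q4_1 q4_2 q4_3 q4_4 q4_5 q4_6
  have "D 2 = 0" "D 3 = 0" "D 4 = 0" "D 5 = 0" "D 6 = 0" "D 7 = 0"
    unfolding vec_eq_iff forall_7 by (simp_all add: zero col zs q1 q2 q3 q4)
  then show ?thesis
    using i forall_7[of "\<lambda>i. i \<noteq> 1 \<longrightarrow> D i = 0"] by simp
qed

section \<open>Limits of matrices\<close>

lemma tendsto_matrix_iff:
  fixes l :: "complex ^ 'n::finite ^ 'm::finite"
  shows "(f \<longlongrightarrow> l) F \<longleftrightarrow> (\<forall>a b. ((\<lambda>x. f x $ a $ b) \<longlongrightarrow> l $ a $ b) F)"
  by (metis tendsto_vec_nth vec_tendstoI)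

lemma tendsto_matrix_mult:
  fixes A :: "complex ^ 'k::finite ^ 'm::finite" and B :: "complex ^ 'n::finite ^ 'k"
  assumes "(f \<longlongrightarrow> A) F" "(g \<longlongrightarrow> B) F"
  shows "((\<lambda>x. f x ** g x) \<longlongrightarrow> A ** B) F"
proof -
  have "((\<lambda>x. f x $ a $ b) \<longlongrightarrow> A $ a $ b) F" "((\<lambda>x. g x $ c $ d) \<longlongrightarrow> B $ c $ d) F" for a b c d
    using assms by (simp_all add: tendsto_matrix_iff)
  then show ?thesis
    unfolding tendsto_matrix_iff by (auto simp: matrix_matrix_mult_def intro!: tendsto_sum tendsto_mult)
qed

lemma tendsto_det:
  fixes A :: "complex ^ 'n::finite ^ 'n"
  assumes "(f \<longlongrightarrow> A) F"
  shows "((\<lambda>x. det (f x)) \<longlongrightarrow> det A) F"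
proof -
  have "((\<lambda>x. f x $ a $ b) \<longlongrightarrow> A $ a $ b) F" for a b
    using assms by (simp add: tendsto_matrix_iff)
  then show ?thesis
    unfolding det_def by (auto intro!: tendsto_sum tendsto_mult tendsto_prod)
qed

text \<open>Cramer's rule for the \<open>l\<close>-th basis vector. Entries of the inverse become
  quotients of determinants, so inversion inherits continuity from \<open>det\<close>.\<close>

lemma matrix_inv_nth:
  fixes A :: "complex ^ 'n::finite ^ 'n"
  assumes "det A \<noteq> 0"
  shows "matrix_inv A $ k $ l = det (\<chi> i j. if j = k then axis l 1 $ i else A $ i $ j) / det A"
proof -
  have "A ** matrix_inv A = mat 1"
    using assms by (simp add: matrix_inv_mult invertible_det_nz)
  then have "A *v (matrix_inv A *v axis l 1) = axis l 1"
    by (simp add: matrix_vector_mul_assoc)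
  then have "(matrix_inv A *v axis l 1) = (\<chi> k. det (\<chi> i j. if j = k then axis l 1 $ i else A $ i $ j) / det A)"
    using cramer[OF assms] by blast
  moreover have "(matrix_inv A *v axis l 1) $ k = matrix_inv A $ k $ l"
    by (simp add: matrix_vector_mult_def axis_def if_distrib[of "\<lambda>x. _ * x"] cong: if_cong)
  ultimately show ?thesis by simp
qed

lemma eventually_det_nonzero:
  fixes A :: "complex ^ 'n::finite ^ 'n"
  assumes "(f \<longlongrightarrow> A) F" "det A \<noteq> 0"
  shows "\<forall>\<^sub>F x in F. det (f x) \<noteq> 0"
  using tendsto_det[OF assms(1)] assms(2) by (rule tendsto_imp_eventually_ne)

lemma tendsto_matrix_inv:
  fixes A :: "complex ^ 'n::finite ^ 'n"
  assumes lim: "(f \<longlongrightarrow> A) F" and "det A \<noteq> 0"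
  shows "((\<lambda>x. matrix_inv (f x)) \<longlongrightarrow> matrix_inv A) F"
  unfolding tendsto_matrix_iff
proof (intro allI)
  fix k l
  have "((\<lambda>x. \<chi> i j. if j = k then axis l 1 $ i else f x $ i $ j)
      \<longlongrightarrow> (\<chi> i j. if j = k then axis l 1 $ i else A $ i $ j)) F"
    using lim unfolding tendsto_matrix_iff by auto
  then have "((\<lambda>x. det (\<chi> i j. if j = k then axis l 1 $ i else f x $ i $ j) / det (f x))
      \<longlongrightarrow> matrix_inv A $ k $ l) F"
    unfolding matrix_inv_nth[OF assms(2)] using assms by (intro tendsto_divide tendsto_det)
  then show "((\<lambda>x. matrix_inv (f x) $ k $ l) \<longlongrightarrow> matrix_inv A $ k $ l) F"
    by (rule Lim_transform_eventually)
      (use eventually_det_nonzero[OF assms] in \<open>auto elim!: eventually_mono simp: matrix_inv_nth\<close>)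
qed

section \<open>Approximation by reduced algebras\<close>

text \<open>If \<open>U\<close> and \<open>V\<close> are the off-diagonal blocks,
  \<open>N ** N\<close> has diagonal blocks \<open>UV\<close> of size 4 and \<open>VU\<close> of
  size 3. Their traces agree, so \<open>4 * c = 3 * c\<close>.\<close>

lemma scalar_square_imp_nilpotent:
  fixes N :: "complex ^ 7 ^ 7"
  assumes block: "\<And>a b. (a \<in> {5, 6, 7}) = (b \<in> {5, 6, 7}) \<Longrightarrow> N $ a $ b = 0"
    and sq: "N ** N = mat c"
  shows "N ** N = 0"
proof -
  have *: "(N ** N) $ a $ b = mat c $ a $ b" for a b
    using sq by simp
  have "4 * c = (N ** N) $ 1 $ 1 + (N ** N) $ 2 $ 2 + (N ** N) $ 3 $ 3 + (N ** N) $ 4 $ 4"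
    unfolding * by (simp add: mat_def)
  also have "\<dots> = (N ** N) $ 5 $ 5 + (N ** N) $ 6 $ 6 + (N ** N) $ 7 $ 7"
    by (simp add: matrix_matrix_mult_def sum_7 block algebra_simps)
  also have "\<dots> = 3 * c"
    unfolding * by (simp add: mat_def)
  finally have "c = 0" by simp
  then show ?thesis
    using sq by simp
qed

lemma T_end_7_nth_lower:
  assumes "i \<noteq> 1"
  shows "(if a \<in> {5, 6, 7} \<and> b \<notin> {5, 6, 7} then T_end_7 $ i $ a $ b else 0) = T_end_7 $ i $ a $ b"
proof -
  have "\<forall>a b. (if a \<in> {5, 6, 7} \<and> b \<notin> {5, 6, 7} then T_end_7 $ i $ a $ b else 0) = T_end_7 $ i $ a $ b"
    unfolding forall_7 using assms by (simp add: T_end_7_nth T_end_7_matrix_def vector_7 axis_def)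
  then show ?thesis by blast
qed

text \<open>Compactness carries rigidity from \<open>T_end_7\<close> to its neighbours: nonzero
  solutions of the nearby linear systems, scaled to norm 1, would accumulate at a nonzero solution
  of the system at \<open>T_end_7\<close>.\<close>

lemma no_reduced_approximation:
  fixes N :: "nat \<Rightarrow> 7 \<Rightarrow> complex ^ 7 ^ 7"
  assumes lim: "\<And>i. (\<lambda>n. N n i) \<longlonglongrightarrow> T_end_7 $ i"
    and unit: "\<And>n. N n 1 = mat 1"
    and trace: "\<And>n i. i \<noteq> 1 \<Longrightarrow> trace (N n i) = 0"
    and col: "\<And>n a. N n 3 $ a $ 3 = axis 5 1 $ a" "\<And>n a. N n 5 $ a $ 3 = axis 6 1 $ a"
      "\<And>n a. N n 6 $ a $ 3 = axis 7 1 $ a"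
    and comm: "\<And>n i j. N n i ** N n j = N n j ** N n i"
    and prod: "\<And>n i j. \<exists>c. \<forall>a b. (N n i ** N n j) $ a $ b = (\<Sum>k\<in>UNIV. c k * N n k $ a $ b)"
    and red: "\<And>n i. N n i ** N n i = 0 \<Longrightarrow> N n i = 0"
  shows False
proof -
  define I where "I = ({5, 6, 7} :: 7 set)"
  define c where "c n i j = (SOME c. \<forall>a b. (N n i ** N n j) $ a $ b = (\<Sum>k\<in>UNIV. c k * N n k $ a $ b))" for n i j
  have c: "(N n i ** N n j) $ a $ b = (\<Sum>k\<in>UNIV. c n i j k * N n k $ a $ b)" for n i j a b
    using someI_ex[OF prod[of n i j]] unfolding c_def by blast
  \<comment> \<open>\<open>D\<close> holds both diagonal blocks and \<open>C\<close> the structure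
    constants, the unknowns of a linear system with coefficients \<open>S\<close>. Index 1 is zeroed
    out, since \<open>N n 1\<close> is the identity.\<close>
  define D :: "nat \<Rightarrow> complex ^ 7 ^ 7 ^ 7" where
    "D n = (\<chi> i a b. if i \<noteq> 1 \<and> (a \<in> I \<longleftrightarrow> b \<in> I) then N n i $ a $ b else 0)" for n
  define C :: "nat \<Rightarrow> complex ^ 7 ^ 7 ^ 7" where
    "C n = (\<chi> i j k. if i \<noteq> 1 \<and> j \<noteq> 1 \<and> k \<noteq> 1 then c n i j k else 0)" for n
  define S :: "nat \<Rightarrow> 7 \<Rightarrow> complex ^ 7 ^ 7" where
    "S n i = (\<chi> a b. if a \<in> I \<and> b \<notin> I then N n i $ a $ b else 0)" for n i
  \<comment> \<open>In the lower left block, each summand of the product pairs one entry of a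
    diagonal block with one of a lower left block. The term \<open>k = 1\<close> drops out because
    the identity vanishes there.\<close>
  have lin: "(S n i ** D n $ j + D n $ i ** S n j) $ a $ b = (\<Sum>k\<in>UNIV. C n $ i $ j $ k * S n k $ a $ b)"
    if ij: "i \<noteq> 1" "j \<noteq> 1" for n i j a b
  proof (cases "a \<in> I \<and> b \<notin> I")
    case True
    then have ab: "a \<noteq> b" by auto
    have "(S n i ** D n $ j + D n $ i ** S n j) $ a $ b
        = (\<Sum>m\<in>UNIV. S n i $ a $ m * D n $ j $ m $ b + D n $ i $ a $ m * S n j $ m $ b)"
      by (simp add: matrix_matrix_mult_def sum.distrib)
    also have "\<dots> = (N n i ** N n j) $ a $ b"
      unfolding matrix_matrix_mult_def vec_lambda_beta
      by (intro sum.cong refl) (use True ij in \<open>auto simp: S_def D_def\<close>)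
    also have "\<dots> = (\<Sum>k\<in>UNIV. C n $ i $ j $ k * S n k $ a $ b)"
      unfolding c by (intro sum.cong refl) (use True ij ab unit in \<open>auto simp: S_def C_def mat_def\<close>)
    finally show ?thesis .
  next
    case False
    then have "(S n i ** D n $ j) $ a $ b = 0" "(D n $ i ** S n j) $ a $ b = 0"
      unfolding matrix_matrix_mult_def vec_lambda_beta by (auto intro!: sum.neutral simp: S_def D_def)
    moreover have "S n k $ a $ b = 0" for k
      using False by (auto simp: S_def)
    ultimately show ?thesis
      by simp
  qed
  have sym: "S n i ** D n $ j + D n $ i ** S n j = S n j ** D n $ i + D n $ j ** S n i"
    if "i \<noteq> 1" "j \<noteq> 1" for n i j
  proof -
    have "(S n i ** D n $ j + D n $ i ** S n j) $ a $ b = (if a \<in> I \<and> b \<notin> I then (N n i ** N n j) $ a $ b else 0)"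
      if ij: "i \<noteq> 1" "j \<noteq> 1" for i j a b
    proof -
      have "(S n i ** D n $ j + D n $ i ** S n j) $ a $ b
          = (\<Sum>m\<in>UNIV. S n i $ a $ m * D n $ j $ m $ b + D n $ i $ a $ m * S n j $ m $ b)"
        by (simp add: matrix_matrix_mult_def sum.distrib)
      also have "\<dots> = (\<Sum>m\<in>UNIV. if a \<in> I \<and> b \<notin> I then N n i $ a $ m * N n j $ m $ b else 0)"
        by (intro sum.cong refl) (use ij in \<open>auto simp: S_def D_def\<close>)
      also have "\<dots> = (if a \<in> I \<and> b \<notin> I then (N n i ** N n j) $ a $ b else 0)"
        by (cases "a \<in> I \<and> b \<notin> I") (simp_all only: matrix_matrix_mult_def vec_lambda_beta simp_thms if_True if_False sum.neutral_const)
      finally show ?thesis .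
    qed
    then show ?thesis
      using that comm by (simp add: vec_eq_iff)
  qed
  \<comment> \<open>Otherwise \<open>N n 3\<close> would have only off-diagonal blocks and a scalar
    square, hence be zero, against its prescribed third column.\<close>
  have nonzero: "(D n, C n) \<noteq> 0" for n
  proof
    assume "(D n, C n) = 0"
    then have D0: "D n $ i $ a $ b = 0" and C0: "C n $ i $ j $ k = 0" for i j k a b
      by (simp_all add: zero_prod_def)
    have "c n 3 3 k = 0" if "k \<noteq> 1" for k
      using C0[of 3 3 k] that by (simp add: C_def)
    then have "(\<Sum>k\<in>UNIV. c n 3 3 k * N n k $ a $ b) = c n 3 3 1 * mat 1 $ a $ b" for a b
      by (simp add: sum_7 unit)
    then have "N n 3 ** N n 3 = mat (c n 3 3 1)"
      by (simp add: vec_eq_iff c mat_def)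
    moreover have "N n 3 $ a $ b = 0" if "(a \<in> {5, 6, 7}) = (b \<in> {5, 6, 7})" for a b
      using D0[of 3 a b] that by (simp add: D_def I_def split: if_splits)
    ultimately have "N n 3 ** N n 3 = 0"
      by (intro scalar_square_imp_nilpotent)
    then have "N n 3 = 0"
      by (rule red)
    then show False
      using col(1)[of n 5] by simp
  qed
  define z where "z n = (1 / norm (D n, C n)) *\<^sub>R (D n, C n)" for n
  have "z n \<in> sphere 0 1" for n
    unfolding mem_sphere_0 z_def norm_scaleR using nonzero[of n] by simp
  then obtain l r where l: "l \<in> sphere 0 1" and r: "strict_mono r" and zl: "(z \<circ> r) \<longlonglongrightarrow> l"
    using compact_sphere[of "0 :: (complex ^ 7 ^ 7 ^ 7) \<times> (complex ^ 7 ^ 7 ^ 7)" 1] unfolding compact_def by metis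
  define s where "s n = complex_of_real (1 / norm (D (r n), C (r n)))" for n
  have s: "s n * x = (1 / norm (D (r n), C (r n))) *\<^sub>R x" for n x
    by (simp add: s_def scaleR_conv_of_real)
  have Dlim: "(\<lambda>n. s n * D (r n) $ i $ a $ b) \<longlonglongrightarrow> fst l $ i $ a $ b" for i a b
    using tendsto_vec_nth[OF tendsto_vec_nth[OF tendsto_vec_nth[OF tendsto_fst[OF zl]]], of i a b]
    unfolding s by (simp add: z_def o_def)
  have Clim: "(\<lambda>n. s n * C (r n) $ i $ a $ b) \<longlonglongrightarrow> snd l $ i $ a $ b" for i a b
    using tendsto_vec_nth[OF tendsto_vec_nth[OF tendsto_vec_nth[OF tendsto_snd[OF zl]]], of i a b]
    unfolding s by (simp add: z_def o_def)
  have Nlim: "(\<lambda>n. N (r n) i $ a $ b) \<longlonglongrightarrow> T_end_7 $ i $ a $ b" for i a b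
    using LIMSEQ_subseq_LIMSEQ[OF lim r, of i] by (intro tendsto_vec_nth) (simp add: o_def)
  have Slim: "(\<lambda>n. S (r n) i $ a $ b) \<longlonglongrightarrow> T_end_7 $ i $ a $ b" if "i \<noteq> 1" for i a b
  proof -
    have "(\<lambda>n. S (r n) i $ a $ b) \<longlonglongrightarrow> (if a \<in> I \<and> b \<notin> I then T_end_7 $ i $ a $ b else 0)"
      unfolding S_def using Nlim by auto
    then show ?thesis
      unfolding I_def T_end_7_nth_lower[OF that] .
  qed
  have zero: "fst l $ i $ a $ b = 0" if "\<And>n. D n $ i $ a $ b = 0" for i a b
    using LIMSEQ_unique[OF Dlim[of i a b]] that by simp
  have Czero: "snd l $ i $ a $ b = 0" if "i = 1 \<or> a = 1 \<or> b = 1" for i a b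
    using LIMSEQ_unique[OF Clim[of i a b]] that by (auto simp: C_def)
  have L: "(\<lambda>n. s n * (S (r n) i ** D (r n) $ j + D (r n) $ i ** S (r n) j) $ a $ b) \<longlonglongrightarrow>
      (T_end_7 $ i ** fst l $ j + fst l $ i ** T_end_7 $ j) $ a $ b" if "i \<noteq> 1" "j \<noteq> 1" for i j a b
  proof -
    have "(\<lambda>n. (\<Sum>m\<in>UNIV. S (r n) i $ a $ m * (s n * D (r n) $ j $ m $ b))
        + (\<Sum>m\<in>UNIV. s n * D (r n) $ i $ a $ m * S (r n) j $ m $ b)) \<longlonglongrightarrow>
      (\<Sum>m\<in>UNIV. T_end_7 $ i $ a $ m * fst l $ j $ m $ b) + (\<Sum>m\<in>UNIV. fst l $ i $ a $ m * T_end_7 $ j $ m $ b)"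
      using that by (intro tendsto_add tendsto_sum tendsto_mult Dlim Slim)
    then show ?thesis
      by (simp add: matrix_matrix_mult_def sum_distrib_left algebra_simps)
  qed
  have eq: "T_end_7 $ i ** fst l $ j + fst l $ i ** T_end_7 $ j = T_end_7_matrix (snd l $ i $ j)"
    if "i \<noteq> 1" "j \<noteq> 1" for i j
  proof -
    have "(T_end_7 $ i ** fst l $ j + fst l $ i ** T_end_7 $ j) $ a $ b
        = (\<Sum>k\<in>UNIV. snd l $ i $ j $ k * T_end_7 $ k $ a $ b)" for a b
    proof (rule LIMSEQ_unique[OF L[OF that]])
      have "(\<lambda>n. s n * C (r n) $ i $ j $ k * S (r n) k $ a $ b) \<longlonglongrightarrow> snd l $ i $ j $ k * T_end_7 $ k $ a $ b" for k
      \<comment> \<open>\<open>S n 1\<close> does not approximate the identity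
        \<open>T_end_7 $ 1\<close>; the coefficient with index 1 vanishes instead.\<close>
      proof (cases "k = 1")
        case True
        then show ?thesis by (simp add: C_def Czero)
      qed (intro tendsto_mult Clim Slim)
      then have "(\<lambda>n. \<Sum>k\<in>UNIV. s n * C (r n) $ i $ j $ k * S (r n) k $ a $ b)
          \<longlonglongrightarrow> (\<Sum>k\<in>UNIV. snd l $ i $ j $ k * T_end_7 $ k $ a $ b)"
        by (intro tendsto_sum)
      then show "(\<lambda>n. s n * (S (r n) i ** D (r n) $ j + D (r n) $ i ** S (r n) j) $ a $ b)
          \<longlonglongrightarrow> (\<Sum>k\<in>UNIV. snd l $ i $ j $ k * T_end_7 $ k $ a $ b)"
        unfolding lin[OF that] by (simp add: sum_distrib_left mult.assoc)
    qed
    then show ?thesis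
      unfolding contract_A_T_end_7[symmetric] by (simp add: vec_eq_iff contract_A_def)
  qed
  have "fst l $ i = 0" if "i \<noteq> 1" for i
  proof (rule T_end_7_deformation_eq_0[of "\<lambda>i. fst l $ i"])
    show "fst l $ i $ a $ b = 0" if "(a \<in> {5, 6, 7}) \<noteq> (b \<in> {5, 6, 7})" for i a b
      using that by (intro zero) (auto simp: D_def I_def)
    show "\<exists>y. T_end_7 $ i ** fst l $ j + fst l $ i ** T_end_7 $ j = T_end_7_matrix y"
      if "i \<noteq> 1" "j \<noteq> 1" for i j
      using eq[OF that] by blast
    show "T_end_7 $ i ** fst l $ j + fst l $ i ** T_end_7 $ j = T_end_7 $ j ** fst l $ i + fst l $ j ** T_end_7 $ i"
      if "i \<noteq> 1" "j \<noteq> 1" for i j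
      unfolding vec_eq_iff
      using LIMSEQ_unique[OF L[OF that], unfolded sym[OF that]] L[OF that(2,1)] by blast
    show "trace (fst l $ i) = 0" if "i \<noteq> 1" for i
    proof (rule LIMSEQ_unique)
      show "(\<lambda>n. \<Sum>a\<in>UNIV. s n * D (r n) $ i $ a $ a) \<longlonglongrightarrow> trace (fst l $ i)"
        unfolding trace_def by (intro tendsto_sum Dlim)
      have "(\<Sum>a\<in>UNIV. s n * D (r n) $ i $ a $ a) = s n * trace (N (r n) i)" for n
        using that by (simp add: D_def trace_def sum_distrib_left)
      then show "(\<lambda>n. \<Sum>a\<in>UNIV. s n * D (r n) $ i $ a $ a) \<longlonglongrightarrow> 0"
        using that by (simp add: trace)
    qed
    \<comment> \<open>The prescribed third columns have their only nonzero entry in the lower left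
      block, which \<open>D\<close> omits.\<close>
    show "fst l $ 3 $ a $ 3 = 0" "fst l $ 5 $ a $ 3 = 0" "fst l $ 6 $ a $ 3 = 0" for a
      by (intro zero; simp add: D_def I_def col axis_def)+
    show "i \<noteq> 1" by (fact that)
  qed
  moreover have "fst l $ 1 = 0"
    unfolding vec_eq_iff by (auto intro!: zero simp: D_def)
  ultimately have fst0: "fst l = 0"
    by (metis vec_eq_iff zero_index)
  \<comment> \<open>Once the limit of \<open>D\<close> is zero, the limit equation and injectivity
    of \<open>T_end_7_matrix\<close> kill the structure constants.\<close>
  have "snd l $ i $ j = 0" for i j
  proof (cases "i = 1 \<or> j = 1")
    case True
    then show ?thesis by (auto simp: vec_eq_iff Czero)
  next
    case False
    then have "T_end_7_matrix (snd l $ i $ j) = T_end_7 $ i ** 0 + 0 ** T_end_7 $ j"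
      using eq[of i j] fst0 by simp
    also have "\<dots> = T_end_7_matrix 0"
      unfolding vec_eq_iff forall_7 by (simp add: T_end_7_matrix_def vector_7)
    finally show ?thesis
      using inj_T_end_7_matrix by (simp add: inj_eq)
  qed
  then have "snd l = 0"
    by (simp add: vec_eq_iff)
  with fst0 have "l = 0"
    by (simp add: prod_eq_iff)
  with l show False by simp
qed

section \<open>Tensors of rank at most seven\<close>

definition diag_matrix :: "('n \<Rightarrow> 'a::zero) \<Rightarrow> 'a ^ 'n ^ 'n" where
  "diag_matrix d = (\<chi> i j. if i = j then d i else 0)"

lemma mult_diag_matrix_nth:
  fixes P :: "'a::comm_semiring_1 ^ 'n::finite ^ 'm"
  shows "(P ** diag_matrix d) $ a $ l = P $ a $ l * d l"
  by (simp add: matrix_matrix_mult_def diag_matrix_def if_distrib[of "\<lambda>x. _ * x"] cong: if_cong)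

lemma mult_diag_matrix_mult_nth:
  fixes P :: "'a::comm_semiring_1 ^ 'n::finite ^ 'm"
  shows "(P ** diag_matrix d ** Q) $ a $ b = (\<Sum>l\<in>UNIV. P $ a $ l * d l * Q $ l $ b)"
  by (simp add: matrix_matrix_mult_def[of "P ** diag_matrix d"] mult_diag_matrix_nth)

lemma diag_matrix_mult:
  fixes d :: "'n::finite \<Rightarrow> 'a::comm_semiring_1"
  shows "diag_matrix d ** diag_matrix e = diag_matrix (\<lambda>i. d i * e i)"
  by (simp add: vec_eq_iff mult_diag_matrix_nth) (simp add: diag_matrix_def)

lemma diag_matrix_eq_0_iff: "diag_matrix d = 0 \<longleftrightarrow> (\<forall>i. d i = 0)"
  by (auto simp: diag_matrix_def vec_eq_iff)

lemma matrix_diff_rdistrib: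
  fixes A B :: "'a::ring_1 ^ 'n::finite ^ 'm"
  shows "(A - B) ** C = A ** C - B ** C"
  by (simp add: matrix_matrix_mult_def vec_eq_iff left_diff_distrib sum_subtractf)

text \<open>Columns of \<open>A\<close> and \<open>B\<close> and rows of \<open>C\<close> are the
  factors of the rank-one terms, indexed by a type so that slices become matrix products.\<close>

lemma rank_decomposition:
  fixes T :: "('a::finite, 'b::finite, 'c::finite) tensor3"
  assumes "T \<in> sums_of_rank_one CARD('l::finite)"
  obtains A :: "complex ^ 'l ^ 'a" and B :: "complex ^ 'l ^ 'b" and C :: "complex ^ 'c ^ 'l"
  where "\<And>i. T $ i = B ** diag_matrix (($) (A $ i)) ** C"
proof -
  obtain a b c where T: "T = (\<Sum>m<CARD('l). rank_one_tensor (a m) (b m) (c m))"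
    using assms by (auto simp: sums_of_rank_one_def)
  obtain h where h: "bij_betw h (UNIV :: 'l set) {..<CARD('l)}"
    using ex_bij_betw_finite_nat[of "UNIV :: 'l set"] by (auto simp: atLeast0LessThan)
  have "T = (\<Sum>l\<in>UNIV. rank_one_tensor (a (h l)) (b (h l)) (c (h l)))"
    unfolding T by (rule sum.reindex_bij_betw[OF h, symmetric])
  then have "T $ i = (\<chi> j l. b (h l) $ j) ** diag_matrix (($) ((\<chi> i l. a (h l) $ i) $ i)) ** (\<chi> l k. c (h l) $ k)" for i
    by (simp add: vec_eq_iff mult_diag_matrix_mult_nth sum_component rank_one_tensor_def mult_ac)
  then show thesis by (rule that)
qed

lemma sums_of_rank_one_mono:
  assumes "r \<le> s"
  shows "sums_of_rank_one r \<subseteq> (sums_of_rank_one s :: ('a::finite, 'b::finite, 'c::finite) tensor3 set)"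
proof
  fix T :: "('a, 'b, 'c) tensor3" assume "T \<in> sums_of_rank_one r"
  then obtain a b c where T: "T = (\<Sum>l<r. rank_one_tensor (a l) (b l) (c l))"
    by (auto simp: sums_of_rank_one_def)
  \<comment> \<open>The sum is padded with terms whose first factor is zero.\<close>
  have "(\<Sum>l<s. rank_one_tensor (if l < r then a l else 0) (b l) (c l)) = T"
    unfolding T using assms
    by (intro sum.mono_neutral_cong_right) (auto simp: rank_one_tensor_def vec_eq_iff)
  then show "T \<in> sums_of_rank_one s"
    unfolding sums_of_rank_one_def mem_Collect_eq by (intro exI conjI TrueI) (rule sym)
qed

text \<open>The slices share \<open>B\<close> and \<open>C\<close>, so the
  \<open>X i ** matrix_inv (X u)\<close> are simultaneously diagonalizable with eigenvalues
  \<open>A $ i $ l / A $ u $ l\<close>; scalar shifts and conjugation preserve this. Invertibility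
  of \<open>A\<close> makes them span all matrices diagonal in that basis, a space closed under
  products.\<close>

lemma reduced_algebra_of_decomposition:
  fixes X :: "'n::finite \<Rightarrow> complex ^ 'n ^ 'n" and A B C G :: "complex ^ 'n ^ 'n"
  assumes X: "\<And>i. X i = B ** diag_matrix (($) (A $ i)) ** C"
    and "invertible A" "invertible (X u)" "invertible G" "t u = 0"
  defines "N \<equiv> (\<lambda>i. matrix_inv G ** (X i ** matrix_inv (X u) - mat (t i)) ** G)"
  shows "N u = mat 1"
    and "N i ** N j = N j ** N i"
    and "\<exists>c. \<forall>a b. (N i ** N j) $ a $ b = (\<Sum>k\<in>UNIV. c k * N k $ a $ b)"
    and "N i ** N i = 0 \<Longrightarrow> N i = 0"
proof -
  define Y where "Y = matrix_inv (X u)"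
  have Y: "X u ** Y = mat 1"
    using assms(3) by (simp add: Y_def matrix_inv_mult)
  have G: "matrix_inv G ** G = mat 1"
    using assms(4) by (simp add: matrix_inv_mult)
  have "det (diag_matrix (($) (A $ u))) \<noteq> 0"
    using assms(3) by (auto simp: X invertible_det_nz det_mul)
  moreover have "det (diag_matrix (($) (A $ u))) = (\<Prod>l\<in>UNIV. A $ u $ l)"
    by (subst det_diagonal) (simp_all add: diag_matrix_def)
  ultimately have Au: "A $ u $ l \<noteq> 0" for l
    by auto
  define P where "P = matrix_inv G ** B"
  \<comment> \<open>Absorbing the inverse of \<open>X u\<close> into \<open>Q\<close> makes
    \<open>P ** Q\<close> collapse to the identity.\<close>
  define Q where "Q = diag_matrix (($) (A $ u)) ** C ** Y ** G"
  define d where "d i l = A $ i $ l / A $ u $ l - t i" for i l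
  have "P ** Q = matrix_inv G ** (X u ** Y) ** G"
    by (simp add: P_def Q_def X matrix_mul_assoc)
  then have PQ: "P ** Q = mat 1"
    by (simp add: Y G)
  then have QP: "Q ** P = mat 1"
    by (simp add: matrix_left_right_inverse)
  have N: "N i = P ** diag_matrix (d i) ** Q" for i
  proof -
    have mat: "(mat k ** M) $ a $ b = k * M $ a $ b" for k and M :: "complex ^ 'n ^ 'n" and a b
      by (simp add: matrix_matrix_mult_def mat_def if_distrib[of "\<lambda>x. x * _"] cong: if_cong)
    have "diag_matrix (d i) ** diag_matrix (($) (A $ u)) = diag_matrix (\<lambda>l. A $ i $ l - t i * A $ u $ l)"
      unfolding diag_matrix_mult using Au by (simp add: d_def left_diff_distrib)
    then have "B ** diag_matrix (d i) ** diag_matrix (($) (A $ u)) ** C = B ** diag_matrix (\<lambda>l. A $ i $ l - t i * A $ u $ l) ** C"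
      by (simp add: matrix_mul_assoc[symmetric])
    also have "\<dots> = X i - mat (t i) ** X u"
      unfolding X vec_eq_iff vector_minus_component mat mult_diag_matrix_mult_nth
      by (simp add: algebra_simps sum_subtractf sum_distrib_left)
    finally have "B ** diag_matrix (d i) ** diag_matrix (($) (A $ u)) ** C ** Y = X i ** Y - mat (t i) ** (X u ** Y)"
      by (simp add: matrix_diff_rdistrib matrix_mul_assoc)
    then have *: "X i ** Y - mat (t i) = B ** diag_matrix (d i) ** diag_matrix (($) (A $ u)) ** C ** Y"
      by (simp add: Y)
    show ?thesis
      unfolding N_def P_def Q_def Y_def[symmetric] * by (simp only: matrix_mul_assoc)
  qed
  have mult: "(P ** diag_matrix e ** Q) ** (P ** diag_matrix f ** Q) = P ** diag_matrix (\<lambda>l. e l * f l) ** Q" for e f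
  proof -
    have "(P ** diag_matrix e ** Q) ** (P ** diag_matrix f ** Q) = P ** diag_matrix e ** (Q ** P) ** diag_matrix f ** Q"
      by (simp only: matrix_mul_assoc)
    then show ?thesis
      by (simp add: QP matrix_mul_assoc[symmetric] diag_matrix_mult)
  qed
  have du: "d u l = 1" for l
    using Au assms(5) by (simp add: d_def)
  then have "diag_matrix (d u) = mat 1"
    by (simp add: diag_matrix_def mat_def vec_eq_iff)
  then show "N u = mat 1"
    by (simp add: N PQ)
  show "N i ** N j = N j ** N i"
    unfolding N mult by (simp add: mult.commute)
  show "N i = 0" if "N i ** N i = 0"
  proof -
    have "Q ** (N i ** N i) ** P = (Q ** P) ** diag_matrix (\<lambda>l. d i l * d i l) ** (Q ** P)"
      unfolding N mult by (simp only: matrix_mul_assoc)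
    then have "diag_matrix (\<lambda>l. d i l * d i l) = 0"
      using that by (simp add: QP)
    then have "diag_matrix (d i) = 0"
      by (simp add: diag_matrix_eq_0_iff)
    then show ?thesis
      by (simp add: N)
  qed
  show "\<exists>c. \<forall>a b. (N i ** N j) $ a $ b = (\<Sum>k\<in>UNIV. c k * N k $ a $ b)"
  proof -
    \<comment> \<open>The factor \<open>A $ u $ l\<close> compensates the denominator in
      \<open>d\<close>; \<open>\<beta>\<close> expresses \<open>w\<close> in the rows of
      \<open>A\<close>, which form a basis.\<close>
    define w where "w = (\<chi> l. d i l * d j l * A $ u $ l)"
    define \<beta> where "\<beta> = w v* matrix_inv A"
    have "\<beta> v* A = w"
      using assms(2) by (simp add: \<beta>_def vector_matrix_mul_assoc matrix_inv_mult)
    then have w: "w $ l = (\<Sum>k\<in>UNIV. \<beta> $ k * A $ k $ l)" for l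
      by (auto simp: vector_matrix_mult_def mult.commute)
    have *: "d i l * d j l = (\<Sum>k\<in>UNIV. \<beta> $ k * (d k l + t k))" for l
    proof -
      have "d i l * d j l = w $ l / A $ u $ l"
        using Au by (simp add: w_def)
      then show ?thesis
        unfolding w by (simp add: d_def sum_divide_distrib)
    qed
    \<comment> \<open>The shifts \<open>t\<close> add up to a scalar, absorbed by the coefficient of
      \<open>N u\<close>, the identity.\<close>
    define c where "c k = \<beta> $ k + (if k = u then \<Sum>m\<in>UNIV. \<beta> $ m * t m else 0)" for k
    have "(\<Sum>k\<in>UNIV. c k * d k l) = d i l * d j l" for l
      unfolding * c_def by (simp add: du distrib_left distrib_right sum.distrib if_distrib[of "\<lambda>x. x * _"] cong: if_cong)
    then have "(N i ** N j) $ a $ b = (\<Sum>l\<in>UNIV. P $ a $ l * (\<Sum>k\<in>UNIV. c k * d k l) * Q $ l $ b)" for a b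
      unfolding N mult mult_diag_matrix_mult_nth by simp
    also have "\<dots> a b = (\<Sum>k\<in>UNIV. c k * N k $ a $ b)" for a b
      unfolding N mult_diag_matrix_mult_nth sum_distrib_left sum_distrib_right
      by (subst sum.swap) (simp add: mult_ac)
    finally show ?thesis by blast
  qed
qed

text \<open>An approximation of rank at most 7 is normalized by inverting its first slice,
  subtracting traces and conjugating. Each correction is trivial in the limit, so the result still
  tends to \<open>T_end_7\<close>, contradicting \<open>no_reduced_approximation\<close>.\<close>

lemma border_rank_T_end_7: "border_rank T_end_7 \<ge> 8"
proof (rule ccontr)
  assume "\<not> border_rank T_end_7 \<ge> 8"
  then have "border_rank T_end_7 \<le> CARD(7)"
    by simp
  then obtain X where X: "\<And>n. X n \<in> sums_of_rank_one CARD(7)" and Xlim: "X \<longlonglongrightarrow> T_end_7"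
    using border_rank_attained[of T_end_7] sums_of_rank_one_mono by blast
  have Xlim: "(\<lambda>n. X n $ i) \<longlonglongrightarrow> T_end_7 $ i" for i
    using Xlim by (rule tendsto_vec_nth)
  have T1: "T_end_7 $ 1 = mat 1"
    by (simp add: T_end_7_nth T_end_7_matrix_axis_1)
  have "\<exists>(A :: complex ^ 7 ^ 7) B C. \<forall>i. X n $ i = B ** diag_matrix (($) (A $ i)) ** C" for n
    by (rule rank_decomposition[OF X[of n]]) blast
  then obtain A B C :: "nat \<Rightarrow> complex ^ 7 ^ 7"
    where ABC: "\<And>n i. X n $ i = B n ** diag_matrix (($) (A n $ i)) ** C n"
    by metis
  \<comment> \<open>The entries \<open>(p k, q k)\<close> are positions at which \<open>T(A\<^sup>*)\<close> has the entry \<open>x\<^sub>k\<close>.\<close>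
  define p q :: "7 \<Rightarrow> 7" where
    "p k = (vector [1, 6, 6, 5, 6, 6, 7] :: 7 ^ 7) $ k" and
    "q k = (vector [1, 1, 2, 4, 3, 4, 4] :: 7 ^ 7) $ k" for k
  \<comment> \<open>The matrix of these entries tends to the identity and has \<open>A n\<close> as
    left factor, so \<open>A n\<close> is eventually invertible.\<close>
  have "(\<lambda>n. \<chi> i k. X n $ i $ p k $ q k) \<longlonglongrightarrow> (\<chi> i k. T_end_7 $ i $ p k $ q k)"
    unfolding tendsto_matrix_iff using Xlim[unfolded tendsto_matrix_iff] by simp
  moreover have "(\<chi> i k. T_end_7 $ i $ p k $ q k) = (mat 1 :: complex ^ 7 ^ 7)"
    unfolding vec_eq_iff forall_7
    by (simp add: p_def q_def vector_7 T_end_7_nth T_end_7_matrix_def axis_def mat_def)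
  ultimately have "\<forall>\<^sub>F n in sequentially. det (\<chi> i k. X n $ i $ p k $ q k) \<noteq> 0"
    using eventually_det_nonzero by fastforce
  moreover have "(\<chi> i k. X n $ i $ p k $ q k) = A n ** (\<chi> l k. B n $ p k $ l * C n $ l $ q k)" for n
    unfolding ABC mult_diag_matrix_mult_nth by (simp add: vec_eq_iff matrix_matrix_mult_def mult_ac)
  ultimately have A: "\<forall>\<^sub>F n in sequentially. invertible (A n)"
    by (auto elim!: eventually_mono simp: det_mul invertible_det_nz)

  have X1: "\<forall>\<^sub>F n in sequentially. invertible (X n $ 1)"
    unfolding invertible_det_nz by (rule eventually_det_nonzero[OF Xlim]) (simp add: T1)
  define M where "M n i = X n $ i ** matrix_inv (X n $ 1)" for n i
  have M: "(\<lambda>n. M n i) \<longlonglongrightarrow> T_end_7 $ i" for i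
    using tendsto_matrix_mult[OF Xlim[of i] tendsto_matrix_inv[OF Xlim[of 1]]]
    by (simp add: M_def T1 matrix_inv_mat_1)
  \<comment> \<open>Subtracting this scalar makes the 7 by 7 matrices traceless; the value 0 at
    index 1 keeps the unit in place.\<close>
  define t where "t n i = (if i = 1 then 0 else trace (M n i) / 7)" for n i
  have t: "(\<lambda>n. t n i) \<longlonglongrightarrow> 0" for i
  proof (cases "i = 1")
    case False
    then have "trace (T_end_7 $ i) / 7 = 0"
      by (simp add: trace_def sum_7 T_end_7_nth T_end_7_matrix_def vector_7 axis_def)
    moreover have "(\<lambda>n. trace (M n i) / 7) \<longlonglongrightarrow> trace (T_end_7 $ i) / 7"
      unfolding trace_def by (intro tendsto_intros M) simp_all
    ultimately show ?thesis
      using False by (simp add: t_def)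
  qed (simp add: t_def)
  define L where "L n i = M n i - mat (t n i)" for n i
  have L: "(\<lambda>n. L n i) \<longlonglongrightarrow> T_end_7 $ i" for i
  proof -
    have "(\<lambda>n. (mat (t n i) :: complex ^ 7 ^ 7) $ a $ b) \<longlonglongrightarrow> 0" for a b
      by (cases "a = b") (simp_all add: mat_def t)
    then have "(\<lambda>n. mat (t n i) :: complex ^ 7 ^ 7) \<longlonglongrightarrow> 0"
      by (simp add: tendsto_matrix_iff)
    from tendsto_diff[OF M this] show ?thesis
      by (simp add: L_def)
  qed
  \<comment> \<open>Conjugation by this matrix, which maps \<open>e\<^sub>5, e\<^sub>6, e\<^sub>7\<close> to \<open>L\<^sub>3 e\<^sub>3, L\<^sub>5 e\<^sub>3, L\<^sub>6 e\<^sub>3\<close>, normalizes the third columns.\<close>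
  define G where "G n = (\<chi> a b. if b = 5 then L n 3 $ a $ 3 else if b = 6 then L n 5 $ a $ 3
    else if b = 7 then L n 6 $ a $ 3 else mat 1 $ a $ b)" for n
  have G: "G \<longlonglongrightarrow> mat 1"
  proof -
    have "(\<chi> a b. if b = 5 then T_end_7 $ 3 $ a $ 3 else if b = 6 then T_end_7 $ 5 $ a $ 3
      else if b = 7 then T_end_7 $ 6 $ a $ 3 else mat 1 $ a $ b) = (mat 1 :: complex ^ 7 ^ 7)"
      unfolding vec_eq_iff forall_7
      by (simp add: T_end_7_nth T_end_7_matrix_def vector_7 axis_def mat_def)
    moreover have "G \<longlonglongrightarrow> (\<chi> a b. if b = 5 then T_end_7 $ 3 $ a $ 3 else if b = 6 then T_end_7 $ 5 $ a $ 3
      else if b = 7 then T_end_7 $ 6 $ a $ 3 else mat 1 $ a $ b)"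
      unfolding tendsto_matrix_iff
    proof (intro allI)
      fix a b :: 7
      show "(\<lambda>n. G n $ a $ b) \<longlonglongrightarrow> (\<chi> a b. if b = 5 then T_end_7 $ 3 $ a $ 3 else if b = 6 then T_end_7 $ 5 $ a $ 3
        else if b = 7 then T_end_7 $ 6 $ a $ 3 else mat 1 $ a $ b) $ a $ b"
        using L[unfolded tendsto_matrix_iff]
        by (cases "b = 5"; cases "b = 6"; cases "b = 7"; simp add: G_def)
    qed
    ultimately show ?thesis by simp
  qed
  have Ginv: "\<forall>\<^sub>F n in sequentially. invertible (G n)"
    unfolding invertible_det_nz by (rule eventually_det_nonzero[OF G]) simp
  define N where "N n i = matrix_inv (G n) ** L n i ** G n" for n i
  have N: "(\<lambda>n. N n i) \<longlonglongrightarrow> T_end_7 $ i" for i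
    using tendsto_matrix_mult[OF tendsto_matrix_mult[OF tendsto_matrix_inv[OF G] L[of i]] G]
    by (simp add: N_def matrix_inv_mat_1)

  obtain K where K: "invertible (A n)" "invertible (X n $ 1)" "invertible (G n)" if "n \<ge> K" for n
    using eventually_conj[OF A eventually_conj[OF X1 Ginv]] unfolding eventually_sequentially by blast
  have K': "invertible (A (n + K))" "invertible (X (n + K) $ 1)" "invertible (G (n + K))" for n
    by (simp_all add: K)
  have N_eq: "N n i = matrix_inv (G n) ** (X n $ i ** matrix_inv (X n $ 1) - mat (t n i)) ** G n" for n i
    by (simp add: N_def L_def M_def)
  have t1: "t n 1 = 0" for n
    by (simp add: t_def)
  note reduced = reduced_algebra_of_decomposition[where X = "\<lambda>i. X (n + K) $ i" and u = 1
    and G = "G (n + K)" and t = "t (n + K)" for n, OF ABC K' t1, folded N_eq]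
  \<comment> \<open>\<open>G\<close> fixes the third basis vector, and its column \<open>b\<close>
    is the third column of \<open>L i\<close>; applying the inverse of \<open>G\<close> gives the
    \<open>b\<close>-th basis vector.\<close>
  have col: "N (n + K) i $ a $ 3 = axis b 1 $ a"
    if "\<And>a. G (n + K) $ a $ b = L (n + K) i $ a $ 3" for n i a b
  proof -
    have "(P ** G (n + K)) $ a $ 3 = P $ a $ 3" for P :: "complex ^ 7 ^ 7"
      by (simp add: matrix_matrix_mult_def G_def mat_def if_distrib[of "\<lambda>x. _ * x"] cong: if_cong)
    then have "N (n + K) i $ a $ 3 = (matrix_inv (G (n + K)) ** L (n + K) i) $ a $ 3"
      by (simp add: N_def)
    also have "\<dots> = (matrix_inv (G (n + K)) ** G (n + K)) $ a $ b"
      by (simp add: matrix_matrix_mult_def that)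
    finally show ?thesis
      using K'(3) by (simp add: matrix_inv_mult mat_def axis_def)
  qed
  show False
  proof (rule no_reduced_approximation[of "\<lambda>n. N (n + K)"])
    show "(\<lambda>n. N (n + K) i) \<longlonglongrightarrow> T_end_7 $ i" for i
      using N by (rule LIMSEQ_ignore_initial_segment)
    show "trace (N (n + K) i) = 0" if "i \<noteq> 1" for n i
    proof -
      have "trace (N (n + K) i) = trace (G (n + K) ** matrix_inv (G (n + K)) ** L (n + K) i)"
        unfolding N_def using trace_mul_sym by (metis matrix_mul_assoc)
      also have "\<dots> = trace (L (n + K) i)"
        using K'(3) by (simp add: matrix_inv_mult)
      also have "\<dots> = 0"
        using that by (simp add: L_def trace_sub t_def) (simp add: trace_def mat_def)
      finally show ?thesis .
    qed
    show "N (n + K) 3 $ a $ 3 = axis 5 1 $ a" "N (n + K) 5 $ a $ 3 = axis 6 1 $ a"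
      "N (n + K) 6 $ a $ 3 = axis 7 1 $ a" for n a
      by (intro col; simp add: G_def)+
  qed (fact reduced)+
qed

theorem proposition5p3:
  shows "End_closed T_end_7 \<and> border_rank T_end_7 \<ge> 8"
  using End_closed_T_end_7 border_rank_T_end_7 by blast

end
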